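(* Let $(x,n):\Sigma\to\mathbb{R}^3\times S^2$ be a principal net lifting to an $\Omega$-net with edge-labelling $m_{ij}$, associate net $\check{x}$ and associate Gauss map $\check{n}$. Then, for each edge $ij$, $$(\mathrm{d}x_{ij},\mathrm{d}\check{x}_{ij})+(\mathrm{d}n_{ij},\mathrm{d}\check{n}_{ij})=-\frac{2}{m_{ij}}.$$
   Context: Domain: $\Sigma\subset\mathbb{Z}^N$; an edge $ij$ is a pair of points of $\Sigma$ differing by a standard unit vector; a quadrilateral is an elementary square with all four vertices $i,j,k,\ell$ (in cyclic order) in $\Sigma$. A vector-valued $1$-form $\alpha$ assigns $\alpha_{ji}=-\alpha_{ij}$ to each oriented edge from $i$ to $j$; it is closed if $\alpha_{i\ell}+\alpha_{\ell k}+\alpha_{kj}+\alpha_{ji}=0$ on every quadrilateral. $\mathrm{d}x_{ji}=x_j-x_i$. $(\cdot,\cdot)$ on $\mathbb{R}^3$ is the Euclidean inner product. $(x,n)$ is a principal net if on each edge there is $\kappa_{ij}\in\mathbb{R}^\times$ with $\kappa_{ij}x_i+n_i=\kappa_{ij}x_j+n_j$. In $\mathbb{R}^{4,2}$ (form $(\cdot,\cdot)$ of signature $(4,2)$) fix $\mathfrak{p}$ with $(\mathfrak{p},\mathfrak{p})=-1$ and null $\mathfrak{o},\mathfrak{q}\perp\mathfrak{p}$ with $(\mathfrak{o},\mathfrak{q})=-1$, so $\mathbb{R}^{3,1}:=\langle\mathfrak{o},\mathfrak{q}\rangle^\perp=\mathbb{R}^3\oplus\langle\mathfrak{p}\rangle$,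 with orthogonal projection $\pi:\mathbb{R}^{4,2}\to\mathbb{R}^{3,1}$. $\Lambda^2\mathbb{R}^{4,2}$ acts by $(a\wedge b)(z)=(a,z)b-(b,z)a$. The Legendre lift of $(x,n)$ is $f=\langle y,\mathfrak{t}\rangle$, with $y=\mathfrak{o}+x+\tfrac12(x,x)\mathfrak{q}$ and $\mathfrak{t}=n+\mathfrak{p}+(x,n)\mathfrak{q}$. It is assumed regular: (i) on each edge $f_{ij}:=f_i+f_j$ is $3$-dimensional, so $s_{ij}:=f_i\cap f_j$ is $1$-dimensional; (ii) on each quadrilateral $s_{ij}\wedge s_{jk}\wedge s_{k\ell}\wedge s_{\ell i}\ne\{0\}$. $f$ is an $\Omega$-net if it is applicable (equivalently, spanned by Koenigs dual sections): there is a closed $\Lambda^2\mathbb{R}^{4,2}$-valued $1$-form $\eta$ with $\eta_{ij}\in\Lambda^2f_{ij}$ and $\eta_{ij}\wedge s_{ij}\ne\{0\}$ on each edge. $\eta$ is considered up to adding $\mathrm{d}\tau$, $\tau$ a section of $\Lambda^2f$. Associate net and associate Gauss map: $\check x,\check n:\Sigma\to\mathbb{R}^3$ with $\mathrm{d}\check x=\pi(\eta\mathfrak{q})$ and $\mathrm{d}\check n=\pi(\eta\mathfrak{p})$ for a representative $\eta$ with $(\eta\mathfrak{q},\mathfrak{p})=0$. Edge-labelling: for each edge choose $\sigma_i\in f_i$, $\sigma_j\in f_j$ with $\eta_{ji}=\sigma_j\wedge\sigma_i$ and set $m_{ij}=1/(\sigma_i,\sigma_j)\in\mathbb{R}^\times\cup\{\infty\}$;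 this is well defined and unchanged on replacing $\eta$ by $\eta+\mathrm{d}\tau$. ($2/m_{ij}$ is read as $0$ when $m_{ij}=\infty$.) *)

theory Defs
  imports "HOL-Analysis.Analysis"
begin

section \<open>The exterior algebra of \<open>\<real>\<^sup>m\<close>\<close>

text \<open>
  The exterior algebra of \<open>\<real>\<^sup>m\<close> has the basis \<open>e\<^sub>I\<close>, where \<open>I = {i\<^sub>1 < \<dots> < i\<^sub>k}\<close> runs over the sets
  of indices and \<open>e\<^sub>I\<close> is the product of \<open>e\<^bsub>i\<^sub>1\<^esub>, \<dots>, e\<^bsub>i\<^sub>k\<^esub>\<close>.  The product of \<open>e\<^sub>J\<close> and \<open>e\<^sub>K\<close> is \<open>0\<close> unless
  \<open>J\<close> and \<open>K\<close> are disjoint, and then it is \<open>e\<^bsub>J \<union> K\<^esub>\<close> up to the sign of the sorting permutation.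
\<close>

type_synonym 'm ext = "(real, 'm set) vec"

definition wedge ::
  "'m::{finite,linorder} ext \<Rightarrow> 'm ext \<Rightarrow> 'm ext"
  (infixl "\<and>\<^sub>e" 70) where
  "\<omega> \<and>\<^sub>e \<theta> = (\<chi> I. \<Sum>J\<in>Pow I. (-1) ^ card {(j, k). j \<in> J \<and> k \<in> I - J \<and> k < j} * \<omega> $ J * \<theta> $ (I - J))"

definition vec1 :: "real ^ 'm::{finite,linorder} \<Rightarrow> 'm ext" where
  "vec1 v = (\<chi> I. \<Sum>i\<in>UNIV. if I = {i} then v $ i else 0)"

definition Lambda2 :: "(real ^ 'm::{finite,linorder}) set \<Rightarrow> 'm ext set" where
  "Lambda2 U = span {vec1 a \<and>\<^sub>e vec1 b | a b. a \<in> U \<and> b \<in> U}"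

lemma vec1_nth: "vec1 v $ {i} = v $ i"
  by (simp add: vec1_def if_distrib cong: if_cong)

lemma vec1_nth_0: "(\<And>i. I \<noteq> {i}) \<Longrightarrow> vec1 v $ I = 0"
  by (simp add: vec1_def)

lemma vec1_wedge_vec1_nth:
  assumes "i < j"
  shows "(vec1 a \<and>\<^sub>e vec1 b) $ {i, j} = a $ i * b $ j - a $ j * b $ i"
proof -
  have P: "Pow {i, j} = {{}, {i}, {j}, {i, j}}"
    by auto
  have "{(j', k). j' \<in> {i} \<and> k \<in> {i, j} - {i} \<and> k < j'} = {}"
    using assms by auto
  then have c1: "card {(j', k). j' \<in> {i} \<and> k \<in> {i, j} - {i} \<and> k < j'} = 0"
    by (simp only: card.empty)
  have "{(j', k). j' \<in> {j} \<and> k \<in> {i, j} - {j} \<and> k < j'} = {(j, i)}"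
    using assms by auto
  then have c2: "card {(j', k). j' \<in> {j} \<and> k \<in> {i, j} - {j} \<and> k < j'} = 1"
    by simp
  have d: "{i, j} - {i} = {j}" "{i, j} - {j} = {i}"
    using assms by auto
  have z: "vec1 a $ {} = 0" "vec1 b $ {} = 0"
    by (simp_all add: vec1_nth_0)
  have "(vec1 a \<and>\<^sub>e vec1 b) $ {i, j} =
    (\<Sum>J\<in>{{}, {i}, {j}, {i, j}}. (-1) ^ card {(j', k). j' \<in> J \<and> k \<in> {i, j} - J \<and> k < j'}
        * vec1 a $ J * vec1 b $ ({i, j} - J))"
    unfolding wedge_def P[symmetric] by simp
  also have "\<dots> = (\<Sum>J\<in>{{i}, {j}}. (-1) ^ card {(j', k). j' \<in> J \<and> k \<in> {i, j} - J \<and> k < j'}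
        * vec1 a $ J * vec1 b $ ({i, j} - J))"
    by (rule sum.mono_neutral_right) (use z assms in auto)
  also have "\<dots> = (-1) ^ card {(j', k). j' \<in> {i} \<and> k \<in> {i, j} - {i} \<and> k < j'}
        * vec1 a $ {i} * vec1 b $ ({i, j} - {i})
      + (-1) ^ card {(j', k). j' \<in> {j} \<and> k \<in> {i, j} - {j} \<and> k < j'}
        * vec1 a $ {j} * vec1 b $ ({i, j} - {j})"
    using assms by (subst sum.insert) auto
  also have "\<dots> = a $ i * b $ j - a $ j * b $ i"
    unfolding c1 c2 unfolding d vec1_nth by simp
  finally show ?thesis .
qed


section \<open>The space \<open>\<real>\<^sup>4\<^sup>,\<^sup>2\<close>\<close>

type_synonym R42 = "real ^ 6"

definition sig42 :: "6 \<Rightarrow> real" where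
  "sig42 i = (if i < 4 then 1 else -1)"

definition form42 :: "R42 \<Rightarrow> R42 \<Rightarrow> real" where
  "form42 v w = (\<Sum>i\<in>UNIV. sig42 i * v $ i * w $ i)"

text \<open>
  The action of \<open>\<Lambda>\<^sup>2\<real>\<^sup>4\<^sup>,\<^sup>2\<close> on \<open>\<real>\<^sup>4\<^sup>,\<^sup>2\<close> is the linear extension of \<open>(a \<and> b) z = (a, z) b - (b, z) a\<close>; it is
  defined on the basis of \<open>\<Lambda>\<^sup>2\<real>\<^sup>4\<^sup>,\<^sup>2\<close>, and \<open>act_wedge\<close> below is the formula for all \<open>a\<close>, \<open>b\<close>.
\<close>

definition act :: "6 ext \<Rightarrow> R42 \<Rightarrow> R42" where
  "act \<omega> z = (\<Sum>(i, j)\<in>{(i, j). i < j}.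
     \<omega> $ {i, j} *\<^sub>R (form42 (axis i 1) z *\<^sub>R axis j 1 - form42 (axis j 1) z *\<^sub>R axis i 1))"

lemma act_wedge: "act (vec1 a \<and>\<^sub>e vec1 b) z = form42 a z *\<^sub>R b - form42 b z *\<^sub>R a"
proof -
  have ax: "form42 (axis i 1) z = sig42 i * z $ i" for i
  proof -
    have "form42 (axis i 1) z = (\<Sum>k\<in>UNIV. if k = i then sig42 k * z $ k else 0)"
      unfolding form42_def by (rule sum.cong) (auto simp: axis_def)
    then show ?thesis
      by simp
  qed
  have axk: "(axis i 1 :: R42) $ k = (if i = k then 1 else 0)" for i k
    by (simp add: axis_def)
  define F where "F = (\<lambda>(i, j). (a $ i * b $ j) *\<^sub>R
      (form42 (axis i 1) z *\<^sub>R (axis j 1 :: R42) - form42 (axis j 1) z *\<^sub>R axis i 1))"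
  have "act (vec1 a \<and>\<^sub>e vec1 b) z = (\<Sum>p\<in>{(i, j). i < j}. F p + F (prod.swap p))"
    unfolding act_def F_def
    by (rule sum.cong) (auto simp: vec1_wedge_vec1_nth algebra_simps)
  also have "\<dots> = (\<Sum>p\<in>{(i, j). i < j}. F p) + (\<Sum>p\<in>{(i, j). i < j}. F (prod.swap p))"
    by (simp add: sum.distrib)
  also have "(\<Sum>p\<in>{(i, j). i < j}. F (prod.swap p)) = (\<Sum>p\<in>{(i, j). j < i}. F p)"
    by (rule sum.reindex_bij_witness[of _ prod.swap prod.swap]) auto
  also have "(\<Sum>p\<in>{(i, j). i < j}. F p) + (\<Sum>p\<in>{(i, j). j < i}. F p)
      = (\<Sum>p\<in>{(i, j). i < j} \<union> {(i, j). j < i}. F p)"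
    by (rule sum.union_disjoint[symmetric]) auto
  also have "\<dots> = (\<Sum>p\<in>UNIV. F p)"
    by (rule sum.mono_neutral_left) (auto simp: F_def not_less_iff_gr_or_eq)
  also have "\<dots> = (\<Sum>i\<in>UNIV. \<Sum>j\<in>UNIV. F (i, j))"
    by (simp add: sum.cartesian_product)
  also have "\<dots> = form42 a z *\<^sub>R b - form42 b z *\<^sub>R a"
  proof (rule vec_eq_iff[THEN iffD2], rule allI)
    fix k :: 6
    have "(\<Sum>i\<in>UNIV. \<Sum>j\<in>UNIV. F (i, j)) $ k
      = (\<Sum>i\<in>UNIV. \<Sum>j\<in>UNIV. a $ i * b $ j * (sig42 i * z $ i * (if j = k then 1 else 0)))
      - (\<Sum>i\<in>UNIV. \<Sum>j\<in>UNIV. a $ i * b $ j * (sig42 j * z $ j * (if i = k then 1 else 0)))"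
      by (simp add: F_def ax axk algebra_simps flip: sum_subtractf)
    also have "(\<Sum>i\<in>UNIV. \<Sum>j\<in>UNIV. a $ i * b $ j * (sig42 i * z $ i * (if j = k then 1 else 0)))
        = form42 a z * b $ k"
      by (simp add: form42_def sum_distrib_left sum_distrib_right if_distrib algebra_simps cong: if_cong)
    also have "(\<Sum>i\<in>UNIV. \<Sum>j\<in>UNIV. a $ i * b $ j * (sig42 j * z $ j * (if i = k then 1 else 0)))
        = form42 b z * a $ k"
      by (subst sum.swap)
        (simp add: form42_def sum_distrib_left sum_distrib_right if_distrib algebra_simps cong: if_cong)
    finally show "(\<Sum>i\<in>UNIV. \<Sum>j\<in>UNIV. F (i, j)) $ k = (form42 a z *\<^sub>R b - form42 b z *\<^sub>R a) $ k"
      by simp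
  qed
  finally show ?thesis .
qed

text \<open>
  The fixed data \<open>\<pp>, \<oo>, \<qq>\<close>, together with an isometry \<open>\<iota>\<close> of the Euclidean space \<open>\<real>\<^sup>3\<close> onto
  \<open>\<langle>\<oo>, \<qq>, \<pp>\<rangle>\<^sup>\<bottom>\<close>, along which \<open>\<real>\<^sup>3\<close> is regarded as a subspace of \<open>\<real>\<^sup>3\<^sup>,\<^sup>1 = \<langle>\<oo>, \<qq>\<rangle>\<^sup>\<bottom>\<close>.
\<close>

definition lie_frame :: "R42 \<Rightarrow> R42 \<Rightarrow> R42 \<Rightarrow> (real ^ 3 \<Rightarrow> R42) \<Rightarrow> bool" where
  "lie_frame \<pp> \<oo> \<qq> \<iota> \<longleftrightarrow>
     form42 \<pp> \<pp> = -1 \<and> form42 \<oo> \<oo> = 0 \<and> form42 \<qq> \<qq> = 0 \<and>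
     form42 \<oo> \<pp> = 0 \<and> form42 \<qq> \<pp> = 0 \<and> form42 \<oo> \<qq> = -1 \<and>
     linear \<iota> \<and> (\<forall>a b. form42 (\<iota> a) (\<iota> b) = a \<bullet> b) \<and>
     range \<iota> = {z. form42 z \<oo> = 0 \<and> form42 z \<qq> = 0 \<and> form42 z \<pp> = 0}"

definition R31 :: "R42 \<Rightarrow> R42 \<Rightarrow> R42 set" where
  "R31 \<oo> \<qq> = {z. form42 z \<oo> = 0 \<and> form42 z \<qq> = 0}"

definition proj31 :: "R42 \<Rightarrow> R42 \<Rightarrow> R42 \<Rightarrow> R42" where
  "proj31 \<oo> \<qq> z = (THE w. w \<in> R31 \<oo> \<qq> \<and> (\<forall>u\<in>R31 \<oo> \<qq>. form42 (z - w) u = 0))"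


section \<open>Discrete domains and forms\<close>

definition edge :: "(int ^ 'N) set \<Rightarrow> int ^ 'N \<Rightarrow> int ^ 'N \<Rightarrow> bool" where
  "edge \<Sigma> i j \<longleftrightarrow> i \<in> \<Sigma> \<and> j \<in> \<Sigma> \<and> (\<exists>a. j = i + axis a 1 \<or> i = j + axis a 1)"

text \<open>The vertices are in cyclic order, with arbitrary first vertex and sense of rotation.\<close>

definition quad :: "(int ^ 'N) set \<Rightarrow> int ^ 'N \<Rightarrow> int ^ 'N \<Rightarrow> int ^ 'N \<Rightarrow> int ^ 'N \<Rightarrow> bool" where
  "quad \<Sigma> i j k l \<longleftrightarrow> {i, j, k, l} \<subseteq> \<Sigma> \<and>
     (\<exists>a b s t. a \<noteq> b \<and> s \<in> {1, -1} \<and> t \<in> {1, -1} \<and>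
        j = i + axis a s \<and> k = i + axis a s + axis b t \<and> l = i + axis b t)"

text \<open>
  As in the notation \<open>\<alpha>\<^sub>j\<^sub>i\<close>, the value of a 1-form \<open>\<alpha>\<close> on the edge oriented from \<open>i\<close> to \<open>j\<close> is \<open>\<alpha> j i\<close>.
\<close>

definition one_form ::
  "(int ^ 'N) set \<Rightarrow> (int ^ 'N \<Rightarrow> int ^ 'N \<Rightarrow> 'v::ab_group_add) \<Rightarrow> bool" where
  "one_form \<Sigma> \<alpha> \<longleftrightarrow> (\<forall>i j. edge \<Sigma> i j \<longrightarrow> \<alpha> j i = - \<alpha> i j)"

definition closed_form ::
  "(int ^ 'N) set \<Rightarrow> (int ^ 'N \<Rightarrow> int ^ 'N \<Rightarrow> 'v::ab_group_add) \<Rightarrow> bool" where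
  "closed_form \<Sigma> \<alpha> \<longleftrightarrow> one_form \<Sigma> \<alpha> \<and>
     (\<forall>i j k l. quad \<Sigma> i j k l \<longrightarrow> \<alpha> i l + \<alpha> l k + \<alpha> k j + \<alpha> j i = 0)"

definition dd :: "(int ^ 'N \<Rightarrow> 'v::ab_group_add) \<Rightarrow> int ^ 'N \<Rightarrow> int ^ 'N \<Rightarrow> 'v" where
  "dd x j i = x j - x i"


section \<open>Principal nets and their Legendre lifts\<close>

definition principal_net ::
  "(int ^ 'N) set \<Rightarrow> (int ^ 'N \<Rightarrow> real ^ 3) \<Rightarrow> (int ^ 'N \<Rightarrow> real ^ 3) \<Rightarrow> bool" where
  "principal_net \<Sigma> x n \<longleftrightarrow>
     (\<forall>i j. edge \<Sigma> i j \<longrightarrow> (\<exists>\<kappa>. \<kappa> \<noteq> 0 \<and> \<kappa> *\<^sub>R x i + n i = \<kappa> *\<^sub>R x j + n j))"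

definition legendre_lift ::
  "R42 \<Rightarrow> R42 \<Rightarrow> R42 \<Rightarrow> (real ^ 3 \<Rightarrow> R42) \<Rightarrow>
   (int ^ 'N \<Rightarrow> real ^ 3) \<Rightarrow> (int ^ 'N \<Rightarrow> real ^ 3) \<Rightarrow> int ^ 'N \<Rightarrow> R42 set" where
  "legendre_lift \<pp> \<oo> \<qq> \<iota> x n i =
     span {\<oo> + \<iota> (x i) + (1/2 * (x i \<bullet> x i)) *\<^sub>R \<qq>, \<iota> (n i) + \<pp> + (x i \<bullet> n i) *\<^sub>R \<qq>}"

definition f_edge :: "(int ^ 'N \<Rightarrow> R42 set) \<Rightarrow> int ^ 'N \<Rightarrow> int ^ 'N \<Rightarrow> R42 set" where
  "f_edge f i j = {a + b | a b. a \<in> f i \<and> b \<in> f j}"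

definition s_edge :: "(int ^ 'N \<Rightarrow> R42 set) \<Rightarrow> int ^ 'N \<Rightarrow> int ^ 'N \<Rightarrow> R42 set" where
  "s_edge f i j = f i \<inter> f j"

definition regular_net :: "(int ^ 'N) set \<Rightarrow> (int ^ 'N \<Rightarrow> R42 set) \<Rightarrow> bool" where
  "regular_net \<Sigma> f \<longleftrightarrow>
     (\<forall>i j. edge \<Sigma> i j \<longrightarrow> dim (f_edge f i j) = 3) \<and>
     (\<forall>i j k l. quad \<Sigma> i j k l \<longrightarrow>
        {vec1 a \<and>\<^sub>e vec1 b \<and>\<^sub>e vec1 c \<and>\<^sub>e vec1 d | a b c d.
           a \<in> s_edge f i j \<and> b \<in> s_edge f j k \<and> c \<in> s_edge f k l \<and> d \<in> s_edge f l i} \<noteq> {0})"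


section \<open>\<open>\<Omega>\<close>-nets\<close>

text \<open>
  The net \<open>f\<close> is an \<open>\<Omega>\<close>-net if some \<open>\<eta>\<close> satisfies \<open>omega_form \<Sigma> f \<eta>\<close>.
\<close>

definition omega_form ::
  "(int ^ 'N) set \<Rightarrow> (int ^ 'N \<Rightarrow> R42 set) \<Rightarrow> (int ^ 'N \<Rightarrow> int ^ 'N \<Rightarrow> 6 ext) \<Rightarrow> bool" where
  "omega_form \<Sigma> f \<eta> \<longleftrightarrow> closed_form \<Sigma> \<eta> \<and>
     (\<forall>i j. edge \<Sigma> i j \<longrightarrow>
        \<eta> i j \<in> Lambda2 (f_edge f i j) \<and> {\<eta> i j \<and>\<^sub>e vec1 s | s. s \<in> s_edge f i j} \<noteq> {0})"

text \<open>\<open>\<eta>\<close> and \<open>\<eta>'\<close> represent the same class, that is, differ by \<open>d\<tau>\<close> for a section \<open>\<tau>\<close> of \<open>\<Lambda>\<^sup>2f\<close>.\<close>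

definition same_class ::
  "(int ^ 'N) set \<Rightarrow> (int ^ 'N \<Rightarrow> R42 set) \<Rightarrow> (int ^ 'N \<Rightarrow> int ^ 'N \<Rightarrow> 6 ext) \<Rightarrow>
   (int ^ 'N \<Rightarrow> int ^ 'N \<Rightarrow> 6 ext) \<Rightarrow> bool" where
  "same_class \<Sigma> f \<eta> \<eta>' \<longleftrightarrow>
     (\<exists>\<tau>. (\<forall>i\<in>\<Sigma>. \<tau> i \<in> Lambda2 (f i)) \<and> (\<forall>i j. edge \<Sigma> i j \<longrightarrow> \<eta>' j i = \<eta> j i + dd \<tau> j i))"

definition associate_pair ::
  "R42 \<Rightarrow> R42 \<Rightarrow> R42 \<Rightarrow> (real ^ 3 \<Rightarrow> R42) \<Rightarrow> (int ^ 'N) set \<Rightarrow> (int ^ 'N \<Rightarrow> R42 set) \<Rightarrow>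
   (int ^ 'N \<Rightarrow> int ^ 'N \<Rightarrow> 6 ext) \<Rightarrow>
   (int ^ 'N \<Rightarrow> real ^ 3) \<Rightarrow> (int ^ 'N \<Rightarrow> real ^ 3) \<Rightarrow> bool" where
  "associate_pair \<pp> \<oo> \<qq> \<iota> \<Sigma> f \<eta> xc nc \<longleftrightarrow>
     (\<exists>\<eta>'. same_class \<Sigma> f \<eta> \<eta>' \<and>
        (\<forall>i j. edge \<Sigma> i j \<longrightarrow>
           form42 (act (\<eta>' j i) \<qq>) \<pp> = 0 \<and>
           \<iota> (dd xc j i) = proj31 \<oo> \<qq> (act (\<eta>' j i) \<qq>) \<and>
           \<iota> (dd nc j i) = proj31 \<oo> \<qq> (act (\<eta>' j i) \<pp>)))"

text \<open>
  In \<open>ereal\<close> one has \<open>1 / 0 = \<infinity>\<close> and \<open>c / \<infinity> = 0\<close> for real \<open>c\<close>, as required for \<open>m\<^sub>i\<^sub>j \<in> \<real>\<^sup>\<times> \<union> {\<infinity>}\<close>.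
\<close>

definition edge_labelling ::
  "(int ^ 'N) set \<Rightarrow> (int ^ 'N \<Rightarrow> R42 set) \<Rightarrow> (int ^ 'N \<Rightarrow> int ^ 'N \<Rightarrow> 6 ext) \<Rightarrow>
   (int ^ 'N \<Rightarrow> int ^ 'N \<Rightarrow> ereal) \<Rightarrow> bool" where
  "edge_labelling \<Sigma> f \<eta> m \<longleftrightarrow>
     (\<forall>i j. edge \<Sigma> i j \<longrightarrow>
        (\<exists>\<sigma>i\<in>f i. \<exists>\<sigma>j\<in>f j. \<eta> j i = vec1 \<sigma>j \<and>\<^sub>e vec1 \<sigma>i \<and> m i j = 1 / ereal (form42 \<sigma>i \<sigma>j)))"

end

theory Submission
  imports Defs
begin

text \<open>
  For a 2-vector \<open>\<omega>\<close> the bilinear form \<open>(\<omega> z, w)\<close> is skew.  Applied to \<open>\<omega> = \<eta>'\<^sub>j\<^sub>i\<close>, this turns the left-hand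
  side of the formula into an expression in \<open>\<omega>\<close> and the lifts alone: \<open>dx\<close> and \<open>dn\<close> are the differences
  of the lifts \<open>y\<close> and \<open>\<tt>\<close> up to multiples of \<open>\<qq>\<close>, and these multiples contribute nothing because
  \<open>(\<omega> \<qq>, \<qq>) = 0\<close> by skewness and \<open>(\<omega> \<pp>, \<qq>) = - (\<omega> \<qq>, \<pp>) = 0\<close> by the normalisation of the representative.
  Hence the left-hand side is
  \<open>(\<omega> \<qq>, dy) + (\<omega> \<pp>, d\<tt>)\<close>, a linear functional of \<open>\<omega>\<close> (\<open>inner_associates_eq_edge_pairing\<close>).

  An element \<open>a\<close> of \<open>f\<^sub>i = \<langle>y\<^sub>i, \<tt>\<^sub>i\<rangle>\<close> has coordinates \<open>-(a, \<qq>)\<close> and \<open>-(a, \<pp>)\<close>.  On \<open>\<omega> = \<sigma>\<^sub>j \<and> \<sigma>\<^sub>i\<close> the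
  functional therefore reassembles \<open>\<sigma>\<^sub>i\<close> and \<open>\<sigma>\<^sub>j\<close> from their coordinates and, as \<open>f\<^sub>i\<close> and \<open>f\<^sub>j\<close> are
  isotropic, gives \<open>-2 (\<sigma>\<^sub>i, \<sigma>\<^sub>j)\<close> (\<open>edge_pairing_wedge_across\<close>).  On \<open>\<Lambda>\<^sup>2f\<^sub>i\<close> and \<open>\<Lambda>\<^sup>2f\<^sub>j\<close> it is a multiple
  of \<open>(y\<^sub>j, \<tt>\<^sub>i) - (y\<^sub>i, \<tt>\<^sub>j) = (dx, n\<^sub>i + n\<^sub>j)\<close>, which vanishes because \<open>dx\<close> is parallel to
  \<open>dn = n\<^sub>j - n\<^sub>i\<close> and \<open>|n\<^sub>i| = |n\<^sub>j|\<close>; so the functional does not see the change of representative by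
  \<open>d\<tau>\<close> (\<open>edge_pairing_eq_0_on_Lambda2\<close>).
\<close>

section \<open>The form and the projection of \<open>\<real>\<^sup>4\<^sup>,\<^sup>2\<close>\<close>

lemma form42_add_left: "form42 (a + b) c = form42 a c + form42 b c"
  by (simp add: form42_def algebra_simps sum.distrib)

lemma form42_scaleR_left: "form42 (r *\<^sub>R a) c = r * form42 a c"
  by (simp add: form42_def sum_distrib_left algebra_simps)

lemma form42_commute: "form42 a b = form42 b a"
  by (simp add: form42_def algebra_simps)

lemma form42_add_right: "form42 c (a + b) = form42 c a + form42 c b"
  by (metis form42_add_left form42_commute)

lemma form42_scaleR_right: "form42 c (r *\<^sub>R a) = r * form42 c a"
  by (metis form42_scaleR_left form42_commute)

lemma form42_diff_left: "form42 (a - b) c = form42 a c - form42 b c"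
  by (simp add: form42_def algebra_simps sum_subtractf)

lemma form42_diff_right: "form42 c (a - b) = form42 c a - form42 c b"
  by (metis form42_diff_left form42_commute)

lemma form42_minus_left: "form42 (- a) c = - form42 a c"
  by (simp add: form42_def sum_negf)

lemma form42_minus_right: "form42 c (- a) = - form42 c a"
  by (simp add: form42_def sum_negf)

lemmas form42_bilinear =
  form42_add_left form42_scaleR_left form42_diff_left form42_minus_left
  form42_add_right form42_scaleR_right form42_diff_right form42_minus_right

lemma form42_nondegenerate:
  assumes "\<And>z. form42 z u = 0"
  shows "u = 0"
proof (rule vec_eq_iff[THEN iffD2], rule allI)
  fix i
  have "form42 (axis i 1) u = (\<Sum>k\<in>UNIV. if k = i then sig42 k * u $ k else 0)"
    unfolding form42_def by (rule sum.cong) (auto simp: axis_def)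
  then have "sig42 i * u $ i = 0"
    using assms by simp
  then show "u $ i = 0 $ i"
    by (auto simp: sig42_def split: if_splits)
qed

lemma proj31_eq:
  assumes "form42 \<oo> \<oo> = 0" "form42 \<qq> \<qq> = 0" "form42 \<oo> \<qq> = -1"
  shows "proj31 \<oo> \<qq> z = z + form42 z \<qq> *\<^sub>R \<oo> + form42 z \<oo> *\<^sub>R \<qq>"
proof -
  define P where "P z = z + form42 z \<qq> *\<^sub>R \<oo> + form42 z \<oo> *\<^sub>R \<qq>" for z
  have qo: "form42 \<qq> \<oo> = -1"
    using assms form42_commute by metis
  have P_mem: "P z \<in> R31 \<oo> \<qq>" for z
    using assms qo by (simp add: P_def R31_def form42_bilinear)
  have P_orth: "form42 (z - P z) u = 0" if "u \<in> R31 \<oo> \<qq>" for z u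
    using that by (simp add: P_def R31_def form42_bilinear form42_commute[of _ u])
  show ?thesis
    unfolding proj31_def P_def[symmetric]
  proof (rule the_equality)
    fix w assume w: "w \<in> R31 \<oo> \<qq> \<and> (\<forall>u\<in>R31 \<oo> \<qq>. form42 (z - w) u = 0)"
    define d where "d = w - P z"
    have d: "d \<in> R31 \<oo> \<qq>"
      using w P_mem[of z] by (simp add: d_def R31_def form42_bilinear)
    have d_orth: "form42 u d = 0" if "u \<in> R31 \<oo> \<qq>" for u
      using w P_orth[OF that, of z] that
      by (simp add: d_def form42_diff_left form42_diff_right form42_commute[of u])
    \<comment> \<open>\<open>v\<close> differs from \<open>P v \<in> \<real>\<^sup>3\<^sup>,\<^sup>1\<close> by a vector orthogonal to \<open>d \<in> \<real>\<^sup>3\<^sup>,\<^sup>1\<close>.\<close>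
    have "form42 v d = 0" for v
      using d_orth[OF P_mem[of v]] P_orth[OF d, of v] by (simp add: form42_diff_left)
    then have "d = 0"
      by (rule form42_nondegenerate)
    then show "w = P z"
      by (simp add: d_def)
  qed (use P_mem P_orth in auto)
qed

section \<open>2-vectors as skew forms\<close>

lemma form42_act_commute: "form42 (act \<omega> z) w = - form42 (act \<omega> w) z"
proof -
  have act_form: "form42 (act \<omega> u) v = (\<Sum>(i, j)\<in>{(i, j). i < j}. \<omega> $ {i, j} *
     (form42 (axis i 1) u * form42 (axis j 1) v - form42 (axis j 1) u * form42 (axis i 1) v))" for u v
  proof -
    have "form42 (sum g A) v = (\<Sum>p\<in>A. form42 (g p) v)" if "finite A" for g and A :: "(6 \<times> 6) set"
      using that
      by (induction rule: finite_induct) (simp_all add: form42_add_left, simp add: form42_def)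
    then show ?thesis
      unfolding act_def by (simp add: split_def form42_bilinear)
  qed
  show ?thesis
    unfolding act_form sum_negf[symmetric] by (rule sum.cong) (auto simp: algebra_simps)
qed

lemma linear_act: "linear (\<lambda>\<omega>. act \<omega> z)"
  by (rule linearI)
    (auto simp: act_def split_def scaleR_add_left sum.distrib scaleR_sum_right)

text \<open>The functional \<open>\<omega> \<mapsto> (\<omega> \<qq>, dy) + (\<omega> \<pp>, d\<tt>)\<close> of an edge, with \<open>u = dy\<close> and \<open>v = d\<tt>\<close>.\<close>

definition edge_pairing :: "R42 \<Rightarrow> R42 \<Rightarrow> R42 \<Rightarrow> R42 \<Rightarrow> 6 ext \<Rightarrow> real" where
  "edge_pairing \<pp> \<qq> u v \<omega> = form42 (act \<omega> \<qq>) u + form42 (act \<omega> \<pp>) v"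

lemma linear_edge_pairing: "linear (edge_pairing \<pp> \<qq> u v)"
  by (rule linearI)
    (simp_all add: edge_pairing_def linear_add[OF linear_act] linear_scale[OF linear_act]
      form42_bilinear algebra_simps)

lemma edge_pairing_wedge:
  "edge_pairing \<pp> \<qq> u v (vec1 a \<and>\<^sub>e vec1 b) =
     form42 b (form42 a \<qq> *\<^sub>R u + form42 a \<pp> *\<^sub>R v) - form42 a (form42 b \<qq> *\<^sub>R u + form42 b \<pp> *\<^sub>R v)"
  by (simp add: edge_pairing_def act_wedge form42_bilinear algebra_simps)

lemma edge_pairing_minus: "edge_pairing \<pp> \<qq> (- u) (- v) \<omega> = - edge_pairing \<pp> \<qq> u v \<omega>"
  by (simp add: edge_pairing_def form42_minus_right)

section \<open>The functional on a pair of contact elements\<close>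

text \<open>
  A basis \<open>y\<close>, \<open>t\<close> of an isotropic plane, normalised as the Legendre lift is, so that
  \<open>a = -(a, \<qq>) y - (a, \<pp>) t\<close> for all \<open>a\<close> in the plane.
\<close>

definition contact_basis :: "R42 \<Rightarrow> R42 \<Rightarrow> R42 \<Rightarrow> R42 \<Rightarrow> bool" where
  "contact_basis \<pp> \<qq> y t \<longleftrightarrow>
     form42 y y = 0 \<and> form42 t t = 0 \<and> form42 y t = 0 \<and>
     form42 y \<qq> = -1 \<and> form42 y \<pp> = 0 \<and> form42 t \<qq> = 0 \<and> form42 t \<pp> = -1"

lemma mem_span_pairE:
  assumes "a \<in> span {y, t}"
  obtains r s where "a = r *\<^sub>R y + s *\<^sub>R t"
  using assms by (force simp: span_insert span_singleton algebra_simps)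

lemma edge_pairing_wedge_across:
  assumes "contact_basis \<pp> \<qq> y t" "contact_basis \<pp> \<qq> y' t'"
    and "a \<in> span {y, t}" "b \<in> span {y', t'}"
  shows "edge_pairing \<pp> \<qq> (y' - y) (t' - t) (vec1 b \<and>\<^sub>e vec1 a) = - 2 * form42 a b"
proof -
  obtain r s where a: "a = r *\<^sub>R y + s *\<^sub>R t"
    using assms(3) by (rule mem_span_pairE)
  obtain r' s' where b: "b = r' *\<^sub>R y' + s' *\<^sub>R t'"
    using assms(4) by (rule mem_span_pairE)
  \<comment> \<open>The vector paired with \<open>a\<close> is \<open>-b\<close>, restored from its coordinates, plus an element of \<open>\<langle>y, t\<rangle>\<close>, which
    is orthogonal to \<open>a\<close>.  The vector paired with \<open>b\<close> is likewise \<open>a\<close> plus an element of \<open>\<langle>y', t'\<rangle>\<close>.\<close>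
  have "form42 a (form42 b \<qq> *\<^sub>R (y' - y) + form42 b \<pp> *\<^sub>R (t' - t)) = - form42 a b"
    using assms(1,2) unfolding a b contact_basis_def
    by (simp add: form42_bilinear form42_commute[of t y] algebra_simps)
  moreover have "form42 b (form42 a \<qq> *\<^sub>R (y' - y) + form42 a \<pp> *\<^sub>R (t' - t)) = form42 b a"
    using assms(1,2) unfolding a b contact_basis_def
    by (simp add: form42_bilinear form42_commute[of t' y'] algebra_simps)
  ultimately show ?thesis
    by (simp add: edge_pairing_wedge form42_commute[of b a])
qed

text \<open>
  On the line \<open>\<Lambda>\<^sup>2\<langle>y, t\<rangle>\<close> the functional is a multiple of \<open>(y', t) - (y, t')\<close>.  Hence it is the same for
  all representatives of the class of \<open>\<eta>\<close> once this number is zero on the edge.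
\<close>

lemma edge_pairing_eq_0_on_Lambda2:
  assumes "contact_basis \<pp> \<qq> y t" "form42 y' t = form42 y t'" "\<omega> \<in> Lambda2 (span {y, t})"
  shows "edge_pairing \<pp> \<qq> (y' - y) (t' - t) \<omega> = 0"
proof (rule linear_eq_0_on_span[OF linear_edge_pairing _ assms(3)[unfolded Lambda2_def]])
  fix \<theta> assume "\<theta> \<in> {vec1 a \<and>\<^sub>e vec1 b | a b. a \<in> span {y, t} \<and> b \<in> span {y, t}}"
  then obtain a b where \<theta>: "\<theta> = vec1 a \<and>\<^sub>e vec1 b" and ab: "a \<in> span {y, t}" "b \<in> span {y, t}"
    by blast
  obtain r s where a: "a = r *\<^sub>R y + s *\<^sub>R t"
    using ab(1) by (rule mem_span_pairE)
  obtain r' s' where b: "b = r' *\<^sub>R y + s' *\<^sub>R t"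
    using ab(2) by (rule mem_span_pairE)
  show "edge_pairing \<pp> \<qq> (y' - y) (t' - t) \<theta> = 0"
    using assms(1,2) unfolding \<theta> a b contact_basis_def edge_pairing_wedge
    by (simp add: form42_bilinear form42_commute[of t y] form42_commute[of t y'] algebra_simps)
qed

section \<open>Lifts of a point and of an oriented tangent plane\<close>

text \<open>
  The null vectors of the point sphere \<open>x\<close> and of the plane through \<open>x\<close> with unit normal \<open>n\<close>; they are
  the sections \<open>y\<close> and \<open>\<tt>\<close> that span the Legendre lift.
\<close>

definition point_lift :: "R42 \<Rightarrow> R42 \<Rightarrow> (real ^ 3 \<Rightarrow> R42) \<Rightarrow> real ^ 3 \<Rightarrow> R42" where
  "point_lift \<oo> \<qq> \<iota> x = \<oo> + \<iota> x + (1/2 * (x \<bullet> x)) *\<^sub>R \<qq>"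

definition plane_lift :: "R42 \<Rightarrow> R42 \<Rightarrow> (real ^ 3 \<Rightarrow> R42) \<Rightarrow> real ^ 3 \<Rightarrow> real ^ 3 \<Rightarrow> R42" where
  "plane_lift \<pp> \<qq> \<iota> x n = \<iota> n + \<pp> + (x \<bullet> n) *\<^sub>R \<qq>"

lemma lie_frame_form42:
  assumes "lie_frame \<pp> \<oo> \<qq> \<iota>"
  shows "form42 \<pp> \<pp> = -1" "form42 \<oo> \<oo> = 0" "form42 \<qq> \<qq> = 0"
    "form42 \<oo> \<pp> = 0" "form42 \<pp> \<oo> = 0" "form42 \<qq> \<pp> = 0" "form42 \<pp> \<qq> = 0"
    "form42 \<oo> \<qq> = -1" "form42 \<qq> \<oo> = -1"
    "form42 (\<iota> a) (\<iota> b) = a \<bullet> b"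
    "form42 (\<iota> a) \<oo> = 0" "form42 (\<iota> a) \<qq> = 0" "form42 (\<iota> a) \<pp> = 0"
    "form42 \<oo> (\<iota> a) = 0" "form42 \<qq> (\<iota> a) = 0" "form42 \<pp> (\<iota> a) = 0"
proof -
  have "\<iota> a \<in> {z. form42 z \<oo> = 0 \<and> form42 z \<qq> = 0 \<and> form42 z \<pp> = 0}"
    using assms unfolding lie_frame_def by blast
  then show "form42 (\<iota> a) \<oo> = 0" "form42 (\<iota> a) \<qq> = 0" "form42 (\<iota> a) \<pp> = 0"
    by simp_all
  then show "form42 \<oo> (\<iota> a) = 0" "form42 \<qq> (\<iota> a) = 0" "form42 \<pp> (\<iota> a) = 0"
    by (simp_all add: form42_commute[of _ "\<iota> a"])
qed (use assms form42_commute in \<open>auto simp: lie_frame_def\<close>)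

lemma form42_point_plane_lift:
  assumes "lie_frame \<pp> \<oo> \<qq> \<iota>"
  shows "form42 (point_lift \<oo> \<qq> \<iota> x) (plane_lift \<pp> \<qq> \<iota> x' n') = (x - x') \<bullet> n'"
  using lie_frame_form42[OF assms]
  by (simp add: point_lift_def plane_lift_def form42_bilinear inner_diff_left)

lemma contact_basis_lifts:
  assumes "lie_frame \<pp> \<oo> \<qq> \<iota>" "n \<bullet> n = 1"
  shows "contact_basis \<pp> \<qq> (point_lift \<oo> \<qq> \<iota> x) (plane_lift \<pp> \<qq> \<iota> x n)"
  using form42_point_plane_lift[OF assms(1), of x x n] lie_frame_form42[OF assms(1)] assms(2)
  by (simp add: contact_basis_def point_lift_def plane_lift_def form42_bilinear)

text \<open>
  The edge condition \<open>\<kappa> dx = - dn\<close> gives \<open>(dx, n' + n) = 0\<close>, since \<open>(n' - n, n' + n) = 0\<close>.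
\<close>

lemma form42_point_plane_lift_symmetric:
  assumes "lie_frame \<pp> \<oo> \<qq> \<iota>" "n \<bullet> n = 1" "n' \<bullet> n' = 1"
    and "\<kappa> \<noteq> 0" "\<kappa> *\<^sub>R x + n = \<kappa> *\<^sub>R x' + n'"
  shows "form42 (point_lift \<oo> \<qq> \<iota> x') (plane_lift \<pp> \<qq> \<iota> x n)
    = form42 (point_lift \<oo> \<qq> \<iota> x) (plane_lift \<pp> \<qq> \<iota> x' n')"
proof -
  have "\<kappa> *\<^sub>R (x' - x) = n - n'"
    using assms(5) by (simp add: algebra_simps flip: assms(5))
  then have "\<kappa> * ((x' - x) \<bullet> (n + n')) = (n - n') \<bullet> (n + n')"
    by (metis inner_scaleR_left)
  also have "\<dots> = 0"
    using assms(2,3) by (simp add: inner_diff_left inner_diff_right inner_add_right inner_commute)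
  finally have "(x' - x) \<bullet> (n + n') = 0"
    using assms(4) by simp
  then show ?thesis
    by (simp add: form42_point_plane_lift[OF assms(1)] inner_diff_left inner_add_right)
qed

lemma inner_associates_eq_edge_pairing:
  assumes frame: "lie_frame \<pp> \<oo> \<qq> \<iota>"
    and norm: "form42 (act \<omega> \<qq>) \<pp> = 0"
    and xc: "\<iota> a = proj31 \<oo> \<qq> (act \<omega> \<qq>)"
    and nc: "\<iota> b = proj31 \<oo> \<qq> (act \<omega> \<pp>)"
  shows "(x' - x) \<bullet> a + (n' - n) \<bullet> b =
    edge_pairing \<pp> \<qq> (point_lift \<oo> \<qq> \<iota> x' - point_lift \<oo> \<qq> \<iota> x)
      (plane_lift \<pp> \<qq> \<iota> x' n' - plane_lift \<pp> \<qq> \<iota> x n) \<omega>"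
proof -
  note F = lie_frame_form42[OF frame]
  have lin: "\<iota> (c - d) = \<iota> c - \<iota> d" for c d
    using frame by (auto simp: lie_frame_def linear_diff)
  \<comment> \<open>The projection removes only components along \<open>\<oo>\<close> and \<open>\<qq>\<close>, which are orthogonal to \<open>\<real>\<^sup>3\<close>.\<close>
  have inner: "c \<bullet> d = form42 z (\<iota> c)" if "\<iota> d = proj31 \<oo> \<qq> z" for c d z
  proof -
    have "c \<bullet> d = form42 (\<iota> d) (\<iota> c)"
      by (simp add: F inner_commute)
    also have "\<dots> = form42 z (\<iota> c)"
      using F by (simp add: that proj31_eq form42_bilinear)
    finally show ?thesis .
  qed
  have qq: "form42 (act \<omega> \<qq>) \<qq> = 0"
    using form42_act_commute[of \<omega> \<qq> \<qq>] by simp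
  have pq: "form42 (act \<omega> \<pp>) \<qq> = 0"
    using form42_act_commute[of \<omega> \<pp> \<qq>] norm by simp
  show ?thesis
    unfolding inner[OF xc] inner[OF nc] edge_pairing_def point_lift_def plane_lift_def
    by (simp add: lin form42_bilinear qq pq)
qed

theorem theorem6p7:
  fixes \<Sigma> :: "(int ^ 'N) set"
    and x n xc nc :: "int ^ 'N \<Rightarrow> real ^ 3"
    and \<pp> \<oo> \<qq> :: R42
    and \<iota> :: "real ^ 3 \<Rightarrow> R42"
    and \<eta> :: "int ^ 'N \<Rightarrow> int ^ 'N \<Rightarrow> 6 ext"
    and m :: "int ^ 'N \<Rightarrow> int ^ 'N \<Rightarrow> ereal"
    and f :: "int ^ 'N \<Rightarrow> R42 set"
  assumes "f = legendre_lift \<pp> \<oo> \<qq> \<iota> x n"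
    and "lie_frame \<pp> \<oo> \<qq> \<iota>"
    and "\<forall>i\<in>\<Sigma>. n i \<in> sphere 0 1"
    and "principal_net \<Sigma> x n"
    and "regular_net \<Sigma> f"
    and "omega_form \<Sigma> f \<eta>"
    and "edge_labelling \<Sigma> f \<eta> m"
    and "associate_pair \<pp> \<oo> \<qq> \<iota> \<Sigma> f \<eta> xc nc"
  shows "\<forall>i j. edge \<Sigma> i j \<longrightarrow>
    ereal (dd x i j \<bullet> dd xc i j + dd n i j \<bullet> dd nc i j) = - (2 / m i j)"
proof (intro allI impI)
  fix i j assume e: "edge \<Sigma> i j"
  note frame = assms(2)
  define y where "y k = point_lift \<oo> \<qq> \<iota> (x k)" for k
  define t where "t k = plane_lift \<pp> \<qq> \<iota> (x k) (n k)" for k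
  have f: "f k = span {y k, t k}" for k
    by (simp add: assms(1) legendre_lift_def y_def t_def point_lift_def plane_lift_def)
  have mem: "i \<in> \<Sigma>" "j \<in> \<Sigma>"
    using e by (auto simp: edge_def)
  then have unit: "n i \<bullet> n i = 1" "n j \<bullet> n j = 1"
    using assms(3) by (auto simp: dist_norm norm_eq_1)
  have basis: "contact_basis \<pp> \<qq> (y i) (t i)" "contact_basis \<pp> \<qq> (y j) (t j)"
    unfolding y_def t_def using contact_basis_lifts[OF frame] unit by auto
  obtain \<kappa> where \<kappa>: "\<kappa> \<noteq> 0" "\<kappa> *\<^sub>R x i + n i = \<kappa> *\<^sub>R x j + n j"
    using assms(4) e by (auto simp: principal_net_def)
  have sym: "form42 (y j) (t i) = form42 (y i) (t j)"
    unfolding y_def t_def by (rule form42_point_plane_lift_symmetric[OF frame unit \<kappa>])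
  obtain \<eta>' where "same_class \<Sigma> f \<eta> \<eta>'"
    and norm: "form42 (act (\<eta>' j i) \<qq>) \<pp> = 0"
    and xc: "\<iota> (dd xc j i) = proj31 \<oo> \<qq> (act (\<eta>' j i) \<qq>)"
    and nc: "\<iota> (dd nc j i) = proj31 \<oo> \<qq> (act (\<eta>' j i) \<pp>)"
    using assms(8) e unfolding associate_pair_def by blast
  then obtain \<tau> where \<tau>: "\<tau> i \<in> Lambda2 (f i)" "\<tau> j \<in> Lambda2 (f j)"
    and \<eta>': "\<eta>' j i = \<eta> j i + (\<tau> j - \<tau> i)"
    using e mem by (auto simp: same_class_def dd_def)
  obtain \<sigma>i \<sigma>j where \<sigma>: "\<sigma>i \<in> f i" "\<sigma>j \<in> f j"
    and \<eta>: "\<eta> j i = vec1 \<sigma>j \<and>\<^sub>e vec1 \<sigma>i" and m: "m i j = 1 / ereal (form42 \<sigma>i \<sigma>j)"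
    using assms(7) e unfolding edge_labelling_def by blast
  let ?E = "edge_pairing \<pp> \<qq> (y j - y i) (t j - t i)"
  have \<tau>i: "?E (\<tau> i) = 0"
    using edge_pairing_eq_0_on_Lambda2[OF basis(1) sym] \<tau>(1) by (simp add: f)
  have \<tau>j: "?E (\<tau> j) = 0"
    using edge_pairing_eq_0_on_Lambda2[OF basis(2) sym[symmetric]] \<tau>(2)
      edge_pairing_minus[of \<pp> \<qq> "y i - y j" "t i - t j" "\<tau> j"] by (simp add: f)
  have "dd x i j \<bullet> dd xc i j + dd n i j \<bullet> dd nc i j
      = (x j - x i) \<bullet> dd xc j i + (n j - n i) \<bullet> dd nc j i"
    by (simp add: dd_def inner_diff_left inner_diff_right)
  also have "\<dots> = ?E (\<eta>' j i)"
    unfolding y_def t_def by (rule inner_associates_eq_edge_pairing[OF frame norm xc nc])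
  also have "\<dots> = ?E (\<eta> j i)"
    by (simp add: \<eta>' linear_add[OF linear_edge_pairing] linear_diff[OF linear_edge_pairing] \<tau>i \<tau>j)
  also have "\<dots> = - 2 * form42 \<sigma>i \<sigma>j"
    unfolding \<eta> using edge_pairing_wedge_across[OF basis] \<sigma> by (simp add: f)
  finally have "dd x i j \<bullet> dd xc i j + dd n i j \<bullet> dd nc i j = - 2 * form42 \<sigma>i \<sigma>j" .
  moreover have "2 / m i j = ereal (2 * form42 \<sigma>i \<sigma>j)"
  proof (cases "form42 \<sigma>i \<sigma>j = 0")
    case True
    then show ?thesis
      by (simp add: m one_ereal_def zero_ereal_def[symmetric] divide_ereal_def)
  next
    case False
    then show ?thesis
      by (simp add: m one_ereal_def divide_ereal_def)
  qed
  ultimately show "ereal (dd x i j \<bullet> dd xc i j + dd n i j \<bullet> dd nc i j) = - (2 / m i j)"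
    by simp
qed

end
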